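(* Let $J$ and $K$ be ideals on $\omega$. The following are equivalent: (i) $J$ and $K$ are nearly coherent; (ii) there is an ideal $K'$ on $\omega$ with $J\leq_{\overline{\mathrm{KB}}}K'$ and $K\leq_{\overline{\mathrm{KB}}}K'$; (iii) there is an ideal $K'$ on $\omega$ with $\mathcal{N}^*_J\cup\mathcal{N}^*_K\subseteq\mathcal{N}^*_{K'}\subseteq\mathcal{N}_{K'}\subseteq\mathcal{N}_J\cap\mathcal{N}_K$; (iv) $\mathcal{N}^*_J\subseteq\mathcal{N}_K$.
   Context: An ideal on $\omega$ is a family $J\subseteq\mathcal{P}(\omega)$ closed under subsets and finite unions, containing all finite sets, with $\omega\notin J$; $J^+=\mathcal{P}(\omega)\setminus J$, $J^d=\{\omega\setminus a:a\in J\}$. For $\varphi:\omega\to\omega$, $\varphi^{\to}(J)=\{A:\varphi^{-1}(A)\in J\}$. $J,K$ are nearly coherent iff for some finite-to-one $\varphi:\omega\to\omega$, $\varphi^{\to}(J)\cup\varphi^{\to}(K)$ is contained in some ideal. $J\leq_{\overline{\mathrm{KB}}}K'$ iff there is a finite-to-one $\varphi:\omega\to\omega$ with $\varphi^{\to}(J)\subseteq K'$. ${}^\omega2$ has Lebesgue measure $\mu$; $\Omega$ is the set of clopen subsets. For $\bar c\in{}^\omega\Omega$: $N(\bar c)=\{x:x\in c_n\text{ for infinitely many }n\}$, $\overline{\Omega}=\{\bar c:\mu(N(\bar c))=0\}$, $N_J(\bar c)=\{x:\{n:x\in c_n\}\in J^+\}$, $N^*_J(\bar c)=\{x:\{n:x\in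 c_n\}\in J^d\}$, $\mathcal{N}_J=\{X\subseteq{}^\omega2:\exists\bar c\in\overline{\Omega}\ X\subseteq N_J(\bar c)\}$, $\mathcal{N}^*_J=\{X:\exists\bar c\in\overline{\Omega}\ X\subseteq N^*_J(\bar c)\}$. *)

theory Defs
  imports "HOL-Probability.Probability"
begin

definition omega_ideal :: "nat set set \<Rightarrow> bool" where
  "omega_ideal J \<longleftrightarrow>
     (\<forall>A B. A \<in> J \<and> B \<subseteq> A \<longrightarrow> B \<in> J) \<and>
     (\<forall>A B. A \<in> J \<and> B \<in> J \<longrightarrow> A \<union> B \<in> J) \<and>
     (\<forall>A. finite A \<longrightarrow> A \<in> J) \<and>
     UNIV \<notin> J"

definition ideal_pos :: "nat set set \<Rightarrow> nat set set" where
  "ideal_pos J = UNIV - J"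

definition ideal_dual :: "nat set set \<Rightarrow> nat set set" where
  "ideal_dual J = {UNIV - a | a. a \<in> J}"

definition finite_to_one :: "(nat \<Rightarrow> nat) \<Rightarrow> bool" where
  "finite_to_one \<phi> \<longleftrightarrow> (\<forall>n. finite (\<phi> -` {n}))"

definition push_ideal :: "(nat \<Rightarrow> nat) \<Rightarrow> nat set set \<Rightarrow> nat set set" where
  "push_ideal \<phi> J = {A. \<phi> -` A \<in> J}"

definition nearly_coherent :: "nat set set \<Rightarrow> nat set set \<Rightarrow> bool" where
  "nearly_coherent J K \<longleftrightarrow>
     (\<exists>\<phi>. finite_to_one \<phi> \<and>
        (\<exists>L. omega_ideal L \<and> push_ideal \<phi> J \<union> push_ideal \<phi> K \<subseteq> L))"

definition KB_bar_le :: "nat set set \<Rightarrow> nat set set \<Rightarrow> bool" where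
  "KB_bar_le J K \<longleftrightarrow> (\<exists>\<phi>. finite_to_one \<phi> \<and> push_ideal \<phi> J \<subseteq> K)"

text \<open>
  The Cantor space is the type \<^typ>\<open>nat \<Rightarrow> bool\<close>, whose type-class topology is the product of
  the discrete topologies. Its Lebesgue measure is the product of the fair-coin measures, taken
  here on the Borel sets; the completion has the same values on all sets measured below.
\<close>

definition cantor_measure :: "(nat \<Rightarrow> bool) measure" where
  "cantor_measure = (\<Pi>\<^sub>M n\<in>UNIV. measure_pmf (bernoulli_pmf (1 / 2)))"

definition clopen_sets :: "(nat \<Rightarrow> bool) set set" where
  "clopen_sets = {U. open U \<and> closed U}"

definition limsup_set :: "(nat \<Rightarrow> (nat \<Rightarrow> bool) set) \<Rightarrow> (nat \<Rightarrow> bool) set" where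
  "limsup_set c = {x. infinite {n. x \<in> c n}}"

definition null_seqs :: "(nat \<Rightarrow> (nat \<Rightarrow> bool) set) set" where
  "null_seqs = {c. (\<forall>n. c n \<in> clopen_sets) \<and> emeasure cantor_measure (limsup_set c) = 0}"

definition N_set :: "nat set set \<Rightarrow> (nat \<Rightarrow> (nat \<Rightarrow> bool) set) \<Rightarrow> (nat \<Rightarrow> bool) set" where
  "N_set J c = {x. {n. x \<in> c n} \<in> ideal_pos J}"

definition N_star_set :: "nat set set \<Rightarrow> (nat \<Rightarrow> (nat \<Rightarrow> bool) set) \<Rightarrow> (nat \<Rightarrow> bool) set" where
  "N_star_set J c = {x. {n. x \<in> c n} \<in> ideal_dual J}"

definition N_ideal :: "nat set set \<Rightarrow> (nat \<Rightarrow> bool) set set" where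
  "N_ideal J = {X. \<exists>c\<in>null_seqs. X \<subseteq> N_set J c}"

definition N_star_ideal :: "nat set set \<Rightarrow> (nat \<Rightarrow> bool) set set" where
  "N_star_ideal J = {X. \<exists>c\<in>null_seqs. X \<subseteq> N_star_set J c}"

text \<open>
  Since \<^const>\<open>emeasure\<close> is \<open>0\<close> on non-measurable sets, the condition in \<^const>\<open>null_seqs\<close> relies on
  the following measurability facts.
\<close>

instance bool :: second_countable_topology
proof
  show "\<exists>B :: bool set set. countable B \<and> open = generate_topology B"
    by (intro exI[of _ UNIV] conjI ext)
       (auto intro: generate_topology.Basis Topological_Spaces.open_discrete countable_finite)
qed

lemma sets_cantor_measure: "sets cantor_measure = sets (borel :: (nat \<Rightarrow> bool) measure)"
proof -
  have "sets (borel :: bool measure) = UNIV"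
  proof -
    have "A \<in> sets borel" for A :: "bool set"
      by (rule borel_open) (rule Topological_Spaces.open_discrete)
    then show ?thesis by auto
  qed
  then have "sets (measure_pmf (bernoulli_pmf (1 / 2))) = sets (borel :: bool measure)"
    by simp
  then have "sets cantor_measure = sets (\<Pi>\<^sub>M n\<in>(UNIV::nat set). (borel :: bool measure))"
    unfolding cantor_measure_def by (intro sets_PiM_cong) auto
  then show ?thesis
    by (simp add: sets_PiM_equal_borel)
qed

lemma limsup_set_measurable:
  assumes "\<And>n. c n \<in> clopen_sets"
  shows "limsup_set c \<in> sets cantor_measure"
proof -
  have "limsup_set c = (\<Inter>m. \<Union>n\<in>{m..}. c n)"
    by (auto simp: limsup_set_def infinite_nat_iff_unbounded_le)
  moreover have "c n \<in> sets cantor_measure" for n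
    using assms[of n] by (simp add: sets_cantor_measure clopen_sets_def)
  ultimately show ?thesis
    by auto
qed

end

theory Submission
  imports Defs
begin

text \<open>
  Only \<open>\<N>\<^sup>*\<^sub>J \<subseteq> \<N>\<^sub>K\<close> implying near coherence needs an argument. Let \<open>c\<^sub>n\<close> be the set of \<open>x\<close> vanishing on
  \<open>[n, 2n)\<close>, and suppose \<open>J\<close>, \<open>K\<close> are not nearly coherent. Given \<open>d\<close> with null limsup, split \<open>\<omega>\<close>
  into consecutive finite blocks such that \<open>d\<^sub>n\<close>, for \<open>n\<close> in a block, depends on coordinates up to the
  end of the next block only, and the union of the \<open>d\<^sub>n\<close> from block \<open>k + 1\<close> on has measure tiny
  compared to \<open>2\<^sup>-\<^sup>2\<^sup>s\<close>, where \<open>s\<close> is the start of block \<open>k\<close>. Failure of near coherence for the two ways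
  of merging neighbouring blocks into pairs yields \<open>a \<in> J\<close> and \<open>b \<in> K\<close> such that whenever a block
  meets the complement of \<open>b\<close>, that block and both its neighbours are contained in \<open>a\<close>.
  A random \<open>x\<close> subject to being \<open>0\<close> on \<open>[m, 2m)\<close> for all \<open>m \<notin> a\<close> then has a positive chance to avoid
  \<open>d\<^sub>n\<close> for all \<open>n \<notin> b\<close>: the coordinates forced to be \<open>0\<close> that matter for \<open>d\<^sub>n\<close> lie below \<open>2s\<close>, which
  costs at most a factor \<open>2\<^sup>2\<^sup>s\<close> in measure. Such an \<open>x\<close> lies in \<open>N\<^sup>*\<^sub>J(c)\<close> but not in \<open>N\<^sub>K(d)\<close>.
\<close>

section \<open>Ideals and finite-to-one maps\<close>

lemma omega_idealD:
  assumes "omega_ideal J"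
  shows omega_ideal_subset: "A \<in> J \<Longrightarrow> B \<subseteq> A \<Longrightarrow> B \<in> J"
    and omega_ideal_Un: "A \<in> J \<Longrightarrow> B \<in> J \<Longrightarrow> A \<union> B \<in> J"
    and omega_ideal_finite: "finite A \<Longrightarrow> A \<in> J"
    and omega_ideal_UNIV: "UNIV \<notin> J"
  using assms unfolding omega_ideal_def by blast+

lemma ideal_dual_iff: "A \<in> ideal_dual J \<longleftrightarrow> - A \<in> J"
  unfolding ideal_dual_def by (auto simp flip: Compl_eq_Diff_UNIV intro: exI[of _ "- A"])

lemma N_star_set_iff: "x \<in> N_star_set J c \<longleftrightarrow> {n. x \<notin> c n} \<in> J"
  by (simp add: N_star_set_def ideal_dual_iff Collect_neg_eq)

lemma N_set_iff: "x \<in> N_set J c \<longleftrightarrow> {n. x \<in> c n} \<notin> J"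
  by (simp add: N_set_def ideal_pos_def)

lemma N_star_ideal_subset_N_ideal:
  assumes "omega_ideal J"
  shows "N_star_ideal J \<subseteq> N_ideal J"
proof -
  have "N_star_set J c \<subseteq> N_set J c" for c
  proof
    fix x assume "x \<in> N_star_set J c"
    then have "{n. x \<notin> c n} \<in> J" by (simp add: N_star_set_iff)
    moreover have "{n. x \<in> c n} \<union> {n. x \<notin> c n} = UNIV" by auto
    ultimately show "x \<in> N_set J c"
      using omega_ideal_Un[OF assms] omega_ideal_UNIV[OF assms] by (metis N_set_iff)
  qed
  then show ?thesis
    unfolding N_star_ideal_def N_ideal_def by blast
qed

lemma finite_to_one_vimage:
  assumes "finite_to_one \<phi>" and "finite A"
  shows "finite (\<phi> -` A)"
proof -
  have "\<phi> -` A = (\<Union>k\<in>A. \<phi> -` {k})" by auto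
  then show ?thesis using assms by (simp add: finite_to_one_def)
qed

lemma null_seqs_antimono:
  assumes "c \<in> null_seqs" and "\<And>n. c' n \<in> clopen_sets" and "limsup_set c' \<subseteq> limsup_set c"
  shows "c' \<in> null_seqs"
proof -
  have "emeasure cantor_measure (limsup_set c') \<le> emeasure cantor_measure (limsup_set c)"
    using assms by (intro emeasure_mono limsup_set_measurable) (auto simp: null_seqs_def)
  then show ?thesis
    using assms by (simp add: null_seqs_def)
qed

text \<open>Collect the sequence along the fibres of \<phi>. Finite fibres keep the unions clopen,
  and a point in infinitely many unions lies in infinitely many \<open>c n\<close>. A point outside
  \<open>c' k\<close> avoids every \<open>c n\<close> in the fibre over \<open>k\<close>, so the
  preimage of its exceptional set is in \<open>J\<close>.\<close>

lemma KB_bar_le_N_star_ideal: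
  assumes J: "omega_ideal J" and "KB_bar_le J K"
  shows "N_star_ideal J \<subseteq> N_star_ideal K"
proof
  fix X assume "X \<in> N_star_ideal J"
  then obtain c where c: "c \<in> null_seqs" and X: "X \<subseteq> N_star_set J c"
    by (auto simp: N_star_ideal_def)
  obtain \<phi> where fin: "finite_to_one \<phi>" and sub: "push_ideal \<phi> J \<subseteq> K"
    using assms(2) by (auto simp: KB_bar_le_def)
  define c' where "c' k = (\<Union>n\<in>\<phi> -` {k}. c n)" for k
  have "limsup_set c' \<subseteq> limsup_set c"
  proof
    fix x assume "x \<in> limsup_set c'"
    then have "infinite {k. x \<in> c' k}" by (simp add: limsup_set_def)
    moreover have "{k. x \<in> c' k} = \<phi> ` {n. x \<in> c n}" by (auto simp: c'_def)
    ultimately show "x \<in> limsup_set c"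
      unfolding limsup_set_def by (metis finite_imageI mem_Collect_eq)
  qed
  moreover have "c' k \<in> clopen_sets" for k
    using c fin unfolding c'_def clopen_sets_def null_seqs_def finite_to_one_def
    by (auto intro!: open_UN closed_UN)
  ultimately have "c' \<in> null_seqs"
    using c null_seqs_antimono by blast
  moreover have "N_star_set J c \<subseteq> N_star_set K c'"
  proof
    fix x assume "x \<in> N_star_set J c"
    then have "{n. x \<notin> c n} \<in> J" by (simp add: N_star_set_iff)
    then have "\<phi> -` {k. x \<notin> c' k} \<in> J"
      by (rule omega_ideal_subset[OF J]) (auto simp: c'_def)
    then show "x \<in> N_star_set K c'"
      using sub by (auto simp: N_star_set_iff push_ideal_def)
  qed
  ultimately show "X \<in> N_star_ideal K"
    using X unfolding N_star_ideal_def by blast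
qed

text \<open>Dually, the sequence is pulled back along \<phi>. Repeating each \<open>c k\<close> only
  finitely often adds no point to the limsup.\<close>

lemma KB_bar_le_N_ideal:
  assumes "KB_bar_le J K"
  shows "N_ideal K \<subseteq> N_ideal J"
proof
  fix X assume "X \<in> N_ideal K"
  then obtain c where c: "c \<in> null_seqs" and X: "X \<subseteq> N_set K c"
    by (auto simp: N_ideal_def)
  obtain \<phi> where fin: "finite_to_one \<phi>" and sub: "push_ideal \<phi> J \<subseteq> K"
    using assms by (auto simp: KB_bar_le_def)
  define c' where "c' n = c (\<phi> n)" for n
  have "limsup_set c' \<subseteq> limsup_set c"
  proof
    fix x assume "x \<in> limsup_set c'"
    then have "infinite (\<phi> -` {k. x \<in> c k})" by (simp add: limsup_set_def c'_def vimage_def)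
    then show "x \<in> limsup_set c"
      unfolding limsup_set_def mem_Collect_eq by (rule contrapos_nn) (rule finite_to_one_vimage[OF fin])
  qed
  moreover have "c' n \<in> clopen_sets" for n
    using c by (simp add: c'_def null_seqs_def)
  ultimately have "c' \<in> null_seqs"
    using c null_seqs_antimono by blast
  moreover have "N_set K c \<subseteq> N_set J c'"
  proof
    fix x assume "x \<in> N_set K c"
    then have "{k. x \<in> c k} \<notin> push_ideal \<phi> J"
      using sub unfolding N_set_iff by blast
    then show "x \<in> N_set J c'"
      by (simp add: N_set_iff push_ideal_def c'_def vimage_def)
  qed
  ultimately show "X \<in> N_ideal J"
    using X unfolding N_ideal_def by blast
qed

text \<open>\<open>L\<close> is the family generated by both push-forwards. It satisfies every ideal
  axiom except possibly properness, so without near coherence \<open>UNIV\<close> must split into a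
  \<open>J\<close>-small and a \<open>K\<close>-small part.\<close>

lemma not_nearly_coherentE:
  assumes J: "omega_ideal J" and K: "omega_ideal K"
    and "\<not> nearly_coherent J K" and fin: "finite_to_one \<phi>"
  obtains A B where "A \<union> B = UNIV" "\<phi> -` A \<in> J" "\<phi> -` B \<in> K"
proof -
  define L where "L = {C. \<exists>A B. C \<subseteq> A \<union> B \<and> \<phi> -` A \<in> J \<and> \<phi> -` B \<in> K}"
  have empty: "{} \<in> J" "{} \<in> K"
    using J K omega_ideal_finite by auto
  have push: "push_ideal \<phi> J \<union> push_ideal \<phi> K \<subseteq> L"
  proof
    fix C assume "C \<in> push_ideal \<phi> J \<union> push_ideal \<phi> K"
    then have "C \<subseteq> C \<union> {} \<and> \<phi> -` C \<in> J \<and> \<phi> -` {} \<in> K \<or>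
        C \<subseteq> {} \<union> C \<and> \<phi> -` {} \<in> J \<and> \<phi> -` C \<in> K"
      using empty by (auto simp: push_ideal_def)
    then show "C \<in> L" unfolding L_def by blast
  qed
  then have "\<not> omega_ideal L"
    using assms by (auto simp: nearly_coherent_def)
  moreover have "\<forall>C D. C \<in> L \<and> D \<subseteq> C \<longrightarrow> D \<in> L"
    unfolding L_def by blast
  moreover have "\<forall>C D. C \<in> L \<and> D \<in> L \<longrightarrow> C \<union> D \<in> L"
  proof (intro allI impI)
    fix C D assume "C \<in> L \<and> D \<in> L"
    then obtain A B A' B' where "C \<subseteq> A \<union> B" "D \<subseteq> A' \<union> B'" "\<phi> -` A \<in> J" "\<phi> -` A' \<in> J"
      "\<phi> -` B \<in> K" "\<phi> -` B' \<in> K"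
      by (auto simp: L_def)
    then have "C \<union> D \<subseteq> (A \<union> A') \<union> (B \<union> B')" "\<phi> -` (A \<union> A') \<in> J" "\<phi> -` (B \<union> B') \<in> K"
      using J K by (auto simp: vimage_Un intro: omega_ideal_Un)
    then show "C \<union> D \<in> L" unfolding L_def by blast
  qed
  moreover have "\<forall>C. finite C \<longrightarrow> C \<in> L"
  proof (intro allI impI)
    fix C :: "nat set" assume "finite C"
    then have "\<phi> -` C \<in> J" using finite_to_one_vimage[OF fin] omega_ideal_finite[OF J] by blast
    then show "C \<in> L" using push by (auto simp: push_ideal_def)
  qed
  ultimately have "UNIV \<in> L"
    unfolding omega_ideal_def by blast
  then show ?thesis
    using that by (auto simp: L_def)
qed

section \<open>Measure and clopen sets in the Cantor space\<close>

lemma space_cantor_measure [simp]: "space cantor_measure = UNIV"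
  by (auto simp: cantor_measure_def space_PiM)

lemma product_prob_space_coin: "product_prob_space (\<lambda>n::nat. measure_pmf (bernoulli_pmf (1 / 2)))"
  by unfold_locales

lemma prob_space_cantor_measure: "prob_space cantor_measure"
  unfolding cantor_measure_def by (intro prob_space_PiM prob_space_measure_pmf)

lemma emeasure_cantor_cylinder:
  assumes "finite I"
  shows "emeasure cantor_measure {x. \<forall>i\<in>I. x i \<in> F i} =
    (\<Prod>i\<in>I. emeasure (measure_pmf (bernoulli_pmf (1 / 2))) (F i))"
  using product_prob_space.emeasure_PiM_Collect[OF product_prob_space_coin, of I UNIV F] assms
  by (simp add: cantor_measure_def space_PiM)

text \<open>Translation by the characteristic function of \<open>S\<close> in the group of 0-1
  sequences modulo 2.\<close>

definition flip_on :: "nat set \<Rightarrow> (nat \<Rightarrow> bool) \<Rightarrow> nat \<Rightarrow> bool" where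
  "flip_on S x i = (x i \<noteq> (i \<in> S))"

lemma measurable_flip_on [measurable]: "flip_on S \<in> measurable cantor_measure cantor_measure"
  unfolding cantor_measure_def
proof (rule measurable_PiM_single')
  fix i :: nat
  have "Measurable.pred (\<Pi>\<^sub>M n\<in>UNIV. measure_pmf (bernoulli_pmf (1 / 2))) (\<lambda>x. x i)"
    by measurable
  then show "(\<lambda>x. flip_on S x i) \<in> measurable (\<Pi>\<^sub>M n\<in>UNIV. measure_pmf (bernoulli_pmf (1 / 2)))
      (measure_pmf (bernoulli_pmf (1 / 2)))"
    by (cases "i \<in> S") (simp_all add: flip_on_def)
qed auto

text \<open>The fair coin is invariant under \<open>Not\<close>, so both measures agree on finite
  cylinders, and these determine the product measure.\<close>

lemma distr_flip_on: "distr cantor_measure cantor_measure (flip_on S) = cantor_measure"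
proof -
  let ?coin = "measure_pmf (bernoulli_pmf (1 / 2))"
  have "map_pmf Not (bernoulli_pmf (1 / 2)) = bernoulli_pmf (1 / 2)"
  proof (rule pmf_eqI)
    fix b
    have "pmf (map_pmf Not (bernoulli_pmf (1 / 2))) (\<not> \<not> b) = pmf (bernoulli_pmf (1 / 2)) (\<not> b)"
      by (rule pmf_map_inj') (auto simp: inj_def)
    then show "pmf (map_pmf Not (bernoulli_pmf (1 / 2))) b = pmf (bernoulli_pmf (1 / 2)) b"
      by (cases b) simp_all
  qed
  then have swap: "emeasure ?coin (Not -` F) = emeasure ?coin F" for F
    using emeasure_map_pmf[of Not "bernoulli_pmf (1 / 2)" F] by simp
  have "emeasure (distr cantor_measure cantor_measure (flip_on S))
      (prod_emb UNIV (\<lambda>n. ?coin) I (Pi\<^sub>E I F)) = (\<Prod>i\<in>I. emeasure ?coin (F i))"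
    if "finite I" for I :: "nat set" and F
  proof -
    have cyl: "prod_emb UNIV (\<lambda>n. ?coin) I (Pi\<^sub>E I F) = {x. \<forall>i\<in>I. x i \<in> F i}"
      by (auto simp: prod_emb_def PiE_iff)
    have "flip_on S -` {x. \<forall>i\<in>I. x i \<in> F i} =
        {x. \<forall>i\<in>I. x i \<in> (if i \<in> S then Not -` F i else F i)}"
      unfolding vimage_def mem_Collect_eq by (intro Collect_cong ball_cong) (auto simp: flip_on_def)
    moreover have "prod_emb UNIV (\<lambda>n. ?coin) I (Pi\<^sub>E I F) \<in> sets cantor_measure"
      unfolding cantor_measure_def using that by (intro sets_PiM_I) auto
    ultimately show ?thesis
      using that by (simp add: emeasure_distr cyl emeasure_cantor_cylinder)
        (auto intro!: prod.cong simp: swap)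
  qed
  then show ?thesis
    unfolding cantor_measure_def
    by (intro product_prob_space.PiM_eq[OF product_prob_space_coin]) auto
qed

lemma emeasure_vimage_flip_on:
  assumes "A \<in> sets cantor_measure"
  shows "emeasure cantor_measure (flip_on S -` A) = emeasure cantor_measure A"
  using emeasure_distr[OF measurable_flip_on assms, of S] by (simp add: distr_flip_on)

lemma compact_cantor: "compact (UNIV :: (nat \<Rightarrow> bool) set)"
proof -
  have "compact_space (euclidean :: bool topology)"
    by (simp add: compact_space_def finite_imp_compact)
  then have "compact_space (product_topology (\<lambda>_::nat. euclidean :: bool topology) UNIV)"
    by (simp add: compact_space_product_topology)
  then show ?thesis
    by (simp add: compact_space_def euclidean_product_topology)
qed

lemma open_coord: "open {x :: nat \<Rightarrow> bool. x i = b}"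
proof -
  have "open ((\<lambda>x :: nat \<Rightarrow> bool. x i) -` {b})"
    by (intro open_vimage continuous_on_product_coordinates Topological_Spaces.open_discrete)
  then show ?thesis by (simp add: vimage_def)
qed

lemma open_cylinder: "finite I \<Longrightarrow> open {x :: nat \<Rightarrow> bool. \<forall>i\<in>I. x i = y i}"
proof -
  assume "finite I"
  moreover have "{x. \<forall>i\<in>I. x i = y i} = (\<Inter>i\<in>I. {x. x i = y i})" by auto
  ultimately show ?thesis by (simp add: open_INT open_coord)
qed

lemma closed_cylinder: "closed {x :: nat \<Rightarrow> bool. \<forall>i\<in>I. x i = y i}"
proof -
  have "{x. \<forall>i\<in>I. x i = y i} = - (\<Union>i\<in>I. {x. x i = (\<not> y i)})" by auto
  moreover have "open (\<Union>i\<in>I. {x. x i = (\<not> y i)})" by (intro open_UN ballI open_coord)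
  ultimately show ?thesis by (simp only: closed_Compl)
qed

text \<open>Each point of \<open>U\<close> has a cylinder neighbourhood inside \<open>U\<close>. By
  compactness finitely many of them cover \<open>U\<close>, and \<open>m\<close> bounds their
  lengths.\<close>

lemma clopen_finite_support:
  assumes "U \<in> clopen_sets"
  obtains m where "\<And>x y. (\<And>i. i < m \<Longrightarrow> x i = y i) \<Longrightarrow> x \<in> U \<Longrightarrow> y \<in> U"
proof -
  have U: "open U" "compact U"
    using assms compact_Int_closed[OF compact_cantor, of U] by (auto simp: clopen_sets_def)
  define cyl where "cyl x m = {y :: nat \<Rightarrow> bool. \<forall>i\<in>{..<m}. y i = x i}" for x m
  have "\<exists>m. cyl x m \<subseteq> U" if "x \<in> U" for x
  proof -
    have "openin (product_topology (\<lambda>_. euclidean) UNIV) U"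
      using U by (simp add: euclidean_product_topology)
    then have "\<exists>V. finite {i. V i \<noteq> UNIV} \<and> (\<forall>i. open (V i)) \<and> x \<in> Pi\<^sub>E UNIV V \<and> Pi\<^sub>E UNIV V \<subseteq> U"
      using that unfolding openin_product_topology_alt by simp
    then obtain V where V: "finite {i. V i \<noteq> UNIV}" "x \<in> Pi\<^sub>E UNIV V" "Pi\<^sub>E UNIV V \<subseteq> U"
      by (elim exE conjE)
    then obtain m where m: "{i. V i \<noteq> UNIV} \<subseteq> {..<m}"
      using finite_nat_iff_bounded by blast
    have "cyl x m \<subseteq> Pi\<^sub>E UNIV V"
    proof
      fix y assume "y \<in> cyl x m"
      then have "y i \<in> V i" for i
        using m V(2) by (cases "i < m") (auto simp: cyl_def PiE_iff)
      then show "y \<in> Pi\<^sub>E UNIV V" by auto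
    qed
    with V(3) show ?thesis by blast
  qed
  then obtain f where f: "\<And>x. x \<in> U \<Longrightarrow> cyl x (f x) \<subseteq> U" by metis
  have "U \<subseteq> (\<Union>x\<in>U. cyl x (f x))" by (auto simp: cyl_def)
  then obtain C where C: "C \<subseteq> U" "finite C" "U \<subseteq> (\<Union>x\<in>C. cyl x (f x))"
    using compactE_image[OF U(2), of U "\<lambda>x. cyl x (f x)"] by (auto simp: cyl_def open_cylinder)
  obtain m where m: "\<And>x. x \<in> C \<Longrightarrow> f x \<le> m"
    using C(2) by (metis finite_imageI finite_nat_set_iff_bounded_le imageI)
  show ?thesis
  proof
    fix x y assume eq: "\<And>i. i < m \<Longrightarrow> x i = y i" and "x \<in> U"
    then obtain z where z: "z \<in> C" "x \<in> cyl z (f z)" using C(3) by blast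
    then have "y \<in> cyl z (f z)"
      using eq m[OF z(1)] by (auto simp: cyl_def dest: less_le_trans)
    then show "y \<in> U" using f z C(1) by blast
  qed
qed

text \<open>Length \<open>n\<close> makes the measures summable. Starting at \<open>n\<close> keeps
  late indices from constraining early coordinates, and ending at \<open>2 * n\<close> bounds the
  coordinates that early indices can constrain.\<close>

definition vanishing_seq :: "nat \<Rightarrow> (nat \<Rightarrow> bool) set" where
  "vanishing_seq n = {x. \<forall>i\<in>{n..<2 * n}. x i = False}"

text \<open>The measures are \<open>(1 / 2) ^ n\<close>, so Borel-Cantelli applies.\<close>

lemma vanishing_seq_null: "vanishing_seq \<in> null_seqs"
proof -
  interpret prob_space cantor_measure by (rule prob_space_cantor_measure)
  have clopen: "vanishing_seq n \<in> clopen_sets" for n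
    unfolding vanishing_seq_def clopen_sets_def
    using open_cylinder[of "{n..<2 * n}" "\<lambda>_. False"] closed_cylinder[of "{n..<2 * n}" "\<lambda>_. False"]
    by simp
  then have sets: "vanishing_seq n \<in> sets cantor_measure" for n
    by (simp add: sets_cantor_measure clopen_sets_def)
  have "emeasure cantor_measure (vanishing_seq n) = ennreal ((1 / 2) ^ n)" for n
  proof -
    have "vanishing_seq n = {x. \<forall>i\<in>{n..<2 * n}. x i \<in> {False}}"
      by (simp add: vanishing_seq_def)
    moreover have "emeasure (measure_pmf (bernoulli_pmf (1 / 2))) {False} = ennreal (1 / 2)"
      by (subst emeasure_pmf_single) simp
    ultimately show ?thesis
      by (simp only: emeasure_cantor_cylinder finite_atLeastLessThan prod_constant)
         (simp only: card_atLeastLessThan mult_2 add_diff_cancel_left' ennreal_power[of "1 / 2"])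
  qed
  then have "measure cantor_measure (vanishing_seq n) = (1 / 2) ^ n" for n
    by (simp add: measure_def)
  then have "summable (\<lambda>n. measure cantor_measure (vanishing_seq n))"
    by (simp add: summable_geometric)
  then have "limsup vanishing_seq \<in> null_sets cantor_measure"
    using sets by (intro borel_cantelli_limsup1) (auto simp: emeasure_eq_measure)
  moreover have "limsup vanishing_seq = limsup_set vanishing_seq"
    by (auto simp: limsup_INF_SUP limsup_set_def infinite_nat_iff_unbounded_le)
  ultimately show ?thesis
    using clopen by (auto simp: null_seqs_def null_setsD1)
qed

text \<open>The tail unions decrease to the limsup set; continuity from above gives limit 0.\<close>

lemma null_seqs_tail_small:
  assumes "d \<in> null_seqs" and "0 < \<epsilon>"
  shows "\<exists>m. \<forall>r\<ge>m. emeasure cantor_measure (\<Union>n\<in>{r..}. d n) < \<epsilon>"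
proof -
  interpret prob_space cantor_measure by (rule prob_space_cantor_measure)
  let ?T = "\<lambda>r. \<Union>n\<in>{r..}. d n"
  have "d n \<in> sets cantor_measure" for n
    using assms(1) by (auto simp: null_seqs_def clopen_sets_def sets_cantor_measure)
  moreover have "decseq ?T"
    by (intro antimonoI UN_mono) auto
  ultimately have "(\<lambda>r. emeasure cantor_measure (?T r)) \<longlonglongrightarrow> emeasure cantor_measure (\<Inter>r. ?T r)"
    by (intro Lim_emeasure_decseq) auto
  moreover have "(\<Inter>r. ?T r) = limsup_set d"
    by (auto simp: limsup_set_def infinite_nat_iff_unbounded_le)
  ultimately have "(\<lambda>r. emeasure cantor_measure (?T r)) \<longlonglongrightarrow> 0"
    using assms(1) by (simp add: null_seqs_def)
  then show ?thesis
    using assms(2) by (auto simp: order_tendsto_iff eventually_sequentially)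
qed


text \<open>This bounds the price of allowing arbitrary changes below \<open>m\<close>: there are
  \<open>2 ^ m\<close> translates, all of the measure of \<open>A\<close>.\<close>

lemma emeasure_UN_flip_on_le:
  assumes "A \<in> sets cantor_measure"
  shows "emeasure cantor_measure (\<Union>S\<in>Pow {..<m}. flip_on S -` A) \<le> 2 ^ m * emeasure cantor_measure A"
proof -
  have sets: "flip_on S -` A \<in> sets cantor_measure" for S
    using measurable_sets[OF measurable_flip_on assms, of S] by simp
  have "emeasure cantor_measure (\<Union>S\<in>Pow {..<m}. flip_on S -` A)
      \<le> (\<Sum>S\<in>Pow {..<m}. emeasure cantor_measure (flip_on S -` A))"
    using sets by (intro emeasure_subadditive_finite) auto
  also have "\<dots> = 2 ^ m * emeasure cantor_measure A"
    by (simp add: emeasure_vimage_flip_on[OF assms] card_Pow)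
  finally show ?thesis .
qed

section \<open>Avoiding a null sequence\<close>

lemma interval_partition:
  fixes s :: "nat \<Rightarrow> nat"
  assumes "strict_mono s" and "s 0 = 0"
  obtains \<beta> where "\<And>n. s (\<beta> n) \<le> n" "\<And>n. n < s (Suc (\<beta> n))"
proof -
  have "\<exists>k. s k \<le> n \<and> n < s (Suc k)" for n
  proof -
    have "n < s (Suc n)"
      using strict_mono_imp_increasing[OF assms(1), of "Suc n"] by simp
    then have "\<exists>k. n < s k" by blast
    then have "n < s (LEAST k. n < s k)" by (rule LeastI_ex)
    \<comment> \<open>The least index is a successor because \<open>s 0 = 0\<close>.\<close>
    moreover from this obtain k where k: "(LEAST k. n < s k) = Suc k"
      using assms(2) by (metis not0_implies_Suc not_less_zero)
    moreover have "\<not> n < s k"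
      using not_less_Least[of k "\<lambda>k. n < s k"] k by simp
    ultimately show ?thesis by (metis not_less)
  qed
  then show ?thesis using that by metis
qed

text \<open>Halving \<beta> and halving its successor pair the block indices in two offset ways.
  Equal or adjacent indices share a pair in at least one of them, so a splitting for each pairing
  separates the complements of \<open>a\<close> and \<open>b\<close> by a whole block.\<close>

lemma not_nearly_coherent_buffered:
  assumes J: "omega_ideal J" and K: "omega_ideal K" and "\<not> nearly_coherent J K"
    and fin: "finite_to_one \<beta>"
  obtains a b where "a \<in> J" "b \<in> K"
    "\<And>n. n \<notin> b \<Longrightarrow> 0 < \<beta> n"
    "\<And>n m. n \<notin> b \<Longrightarrow> m \<notin> a \<Longrightarrow> Suc (\<beta> m) < \<beta> n \<or> Suc (\<beta> n) < \<beta> m"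
proof -
  have "finite_to_one (\<lambda>n. \<beta> n div 2)" "finite_to_one (\<lambda>n. Suc (\<beta> n) div 2)"
    unfolding finite_to_one_def
  proof safe
    fix k
    have "finite (\<beta> -` {..2 * k + 1})"
      using finite_to_one_vimage[OF fin] by blast
    then show "finite ((\<lambda>n. \<beta> n div 2) -` {k})" "finite ((\<lambda>n. Suc (\<beta> n) div 2) -` {k})"
      by (auto elim!: rev_finite_subset)
  qed
  then obtain A1 B1 A2 B2 where
    1: "A1 \<union> B1 = UNIV" "(\<lambda>n. \<beta> n div 2) -` A1 \<in> J" "(\<lambda>n. \<beta> n div 2) -` B1 \<in> K" and
    2: "A2 \<union> B2 = UNIV" "(\<lambda>n. Suc (\<beta> n) div 2) -` A2 \<in> J" "(\<lambda>n. Suc (\<beta> n) div 2) -` B2 \<in> K"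
    using not_nearly_coherentE[OF assms(1-3)] by metis
  show ?thesis
  proof
    show "(\<lambda>n. \<beta> n div 2) -` A1 \<union> (\<lambda>n. Suc (\<beta> n) div 2) -` A2 \<in> J"
      by (intro omega_ideal_Un[OF J] 1 2)
    \<comment> \<open>Block 0 is finite, so it may be put into \<open>b\<close>; every remaining
      block then has a predecessor.\<close>
    show "(\<lambda>n. \<beta> n div 2) -` B1 \<union> (\<lambda>n. Suc (\<beta> n) div 2) -` B2 \<union> \<beta> -` {0} \<in> K"
      using fin by (intro omega_ideal_Un[OF K] 1 2 omega_ideal_finite[OF K]) (simp add: finite_to_one_def)
  next
    fix n m
    assume "n \<notin> (\<lambda>n. \<beta> n div 2) -` B1 \<union> (\<lambda>n. Suc (\<beta> n) div 2) -` B2 \<union> \<beta> -` {0}"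
      and "m \<notin> (\<lambda>n. \<beta> n div 2) -` A1 \<union> (\<lambda>n. Suc (\<beta> n) div 2) -` A2"
    then have "\<beta> n div 2 \<noteq> \<beta> m div 2" "Suc (\<beta> n) div 2 \<noteq> Suc (\<beta> m) div 2"
      using 1(1) 2(1) by auto
    moreover have "Suc q div 2 = q div 2 \<or> Suc (Suc q) div 2 = Suc q div 2" for q :: nat
      by presburger
    ultimately have "\<beta> n \<noteq> \<beta> m" "\<beta> n \<noteq> Suc (\<beta> m)" "\<beta> m \<noteq> Suc (\<beta> n)"
      by metis+
    then show "Suc (\<beta> m) < \<beta> n \<or> Suc (\<beta> n) < \<beta> m" by linarith
  qed auto
qed

text \<open>The sequence iterates a function \<open>R\<close> from 0, where \<open>R m\<close> lies
  beyond \<open>m\<close>, beyond the supports of all \<open>d n\<close> with \<open>n < m\<close>,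
  and far enough for a small tail. The exponent \<open>3 * m + 3\<close> leaves \<open>m + 3\<close>
  after a loss of \<open>2 ^ (2 * m)\<close>.\<close>

lemma null_seqs_spread:
  assumes "d \<in> null_seqs"
  obtains s :: "nat \<Rightarrow> nat" where "strict_mono s" "s 0 = 0"
    "\<And>j. emeasure cantor_measure (\<Union>n\<in>{s (Suc j)..}. d n) < ennreal ((1 / 2) ^ (3 * s j + 3))"
    "\<And>j n x y. n < s j \<Longrightarrow> \<forall>i<s (Suc j). x i = y i \<Longrightarrow> x \<in> d n \<Longrightarrow> y \<in> d n"
proof -
  have "\<forall>n. \<exists>m. \<forall>x y. (\<forall>i<m. x i = y i) \<longrightarrow> x \<in> d n \<longrightarrow> y \<in> d n"
    using assms clopen_finite_support unfolding null_seqs_def by (metis (lifting) mem_Collect_eq)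
  then obtain h where h: "\<And>n x y. (\<And>i. i < h n \<Longrightarrow> x i = y i) \<Longrightarrow> x \<in> d n \<Longrightarrow> y \<in> d n"
    by metis
  have "\<forall>m. \<exists>r. m < r \<and> (\<forall>n<m. h n \<le> r) \<and>
      emeasure cantor_measure (\<Union>n\<in>{r..}. d n) < ennreal ((1 / 2) ^ (3 * m + 3))"
  proof
    fix m
    obtain t where t: "\<And>r. t \<le> r \<Longrightarrow>
        emeasure cantor_measure (\<Union>n\<in>{r..}. d n) < ennreal ((1 / 2) ^ (3 * m + 3))"
      using null_seqs_tail_small[OF assms, of "ennreal ((1 / 2) ^ (3 * m + 3))"] by auto
    \<comment> \<open>The sum serves as a common bound for the finitely many \<open>h n\<close> with
      \<open>n < m\<close>.\<close>
    have "h n \<le> (\<Sum>n<m. h n)" if "n < m" for n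
      using that by (intro member_le_sum) auto
    then show "\<exists>r. m < r \<and> (\<forall>n<m. h n \<le> r) \<and>
        emeasure cantor_measure (\<Union>n\<in>{r..}. d n) < ennreal ((1 / 2) ^ (3 * m + 3))"
      by (intro exI[of _ "Suc m + t + (\<Sum>n<m. h n)"] conjI t) (auto intro: le_SucI trans_le_add2)
  qed
  then obtain R where R: "\<And>m. m < R m" "\<And>m n. n < m \<Longrightarrow> h n \<le> R m"
    "\<And>m. emeasure cantor_measure (\<Union>n\<in>{R m..}. d n) < ennreal ((1 / 2) ^ (3 * m + 3))"
    by metis
  show ?thesis
  proof (rule that[of "\<lambda>j. (R ^^ j) 0"])
    show "strict_mono (\<lambda>j. (R ^^ j) 0)"
      using R(1) by (simp add: strict_mono_Suc_iff)
    show "emeasure cantor_measure (\<Union>n\<in>{(R ^^ Suc j) 0..}. d n) < ennreal ((1 / 2) ^ (3 * (R ^^ j) 0 + 3))" for j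
      using R(3)[of "(R ^^ j) 0"] by simp
    show "y \<in> d n" if "n < (R ^^ j) 0" "\<forall>i<(R ^^ Suc j) 0. x i = y i" "x \<in> d n" for j n x y
      using that R(2)[OF that(1)] h[of n x y] by (auto dest: less_le_trans)
  qed simp
qed

lemma not_nearly_coherent_avoid:
  assumes J: "omega_ideal J" and K: "omega_ideal K" and "\<not> nearly_coherent J K"
    and d: "d \<in> null_seqs"
  shows "\<exists>y. y \<in> N_star_set J vanishing_seq \<and> y \<notin> N_set K d"
proof -
  interpret prob_space cantor_measure by (rule prob_space_cantor_measure)
  obtain s where s: "strict_mono s" "s 0 = 0"
    and tail: "\<And>j. emeasure cantor_measure (\<Union>n\<in>{s (Suc j)..}. d n) < ennreal ((1 / 2) ^ (3 * s j + 3))"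
    and supp: "\<And>j n x y. n < s j \<Longrightarrow> \<forall>i<s (Suc j). x i = y i \<Longrightarrow> x \<in> d n \<Longrightarrow> y \<in> d n"
    using null_seqs_spread[OF d] by metis
  have s_mono: "s i \<le> s j" if "i \<le> j" for i j
    using s(1) that by (simp add: strict_mono_less_eq)
  obtain \<beta> where \<beta>: "\<And>n. s (\<beta> n) \<le> n" "\<And>n. n < s (Suc (\<beta> n))"
    using interval_partition[OF s] by metis
  have fin: "finite_to_one \<beta>"
    unfolding finite_to_one_def
  proof
    fix k
    have "\<beta> -` {k} \<subseteq> {..<s (Suc k)}" using \<beta>(2) by auto
    then show "finite (\<beta> -` {k})" using finite_subset by blast
  qed
  obtain a b where a: "a \<in> J" and b: "b \<in> K" and pos: "\<And>n. n \<notin> b \<Longrightarrow> 0 < \<beta> n"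
    and buf: "\<And>n m. n \<notin> b \<Longrightarrow> m \<notin> a \<Longrightarrow> Suc (\<beta> m) < \<beta> n \<or> Suc (\<beta> n) < \<beta> m"
    using not_nearly_coherent_buffered[OF assms(1-3) fin] by metis
  \<comment> \<open>\<open>D j\<close> is the part of \<open>d\<close> indexed by block
    \<open>j + 1\<close>. \<open>E j\<close> consists of the points that some change of coordinates
    below \<open>2 * s j\<close> moves into \<open>D j\<close>; avoiding it protects against every
    pattern of forced zeros there.\<close>
  define D where "D j = (\<Union>n\<in>{s (Suc j)..<s (Suc (Suc j))}. d n)" for j
  define E where "E j = (\<Union>S\<in>Pow {..<2 * s j}. flip_on S -` D j)" for j
  have d_sets [measurable]: "d n \<in> sets cantor_measure" for n
    using d by (auto simp: null_seqs_def clopen_sets_def sets_cantor_measure)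
  then have D_sets: "D j \<in> sets cantor_measure" for j
    unfolding D_def by auto
  then have E_sets: "E j \<in> sets cantor_measure" for j
    unfolding E_def using measurable_sets[OF measurable_flip_on] by (auto intro!: sets.finite_UN)
  have E_le: "emeasure cantor_measure (E j) \<le> ennreal ((1 / 2) ^ (j + 3))" for j
  proof -
    have "emeasure cantor_measure (D j) \<le> emeasure cantor_measure (\<Union>n\<in>{s (Suc j)..}. d n)"
      unfolding D_def by (intro emeasure_mono) auto
    also have "\<dots> \<le> ennreal ((1 / 2) ^ (3 * s j + 3))"
      using tail less_imp_le by blast
    finally have "emeasure cantor_measure (E j) \<le> 2 ^ (2 * s j) * ennreal ((1 / 2) ^ (3 * s j + 3))"
      unfolding E_def by (intro order_trans[OF emeasure_UN_flip_on_le[OF D_sets]] mult_left_mono) auto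
    also have "\<dots> = ennreal (2 ^ (2 * s j) * (1 / 2) ^ (3 * s j + 3))"
      by (simp add: ennreal_mult flip: ennreal_power)
    also have "2 ^ (2 * s j) * (1 / 2) ^ (3 * s j + 3) = (1 / 2 :: real) ^ (s j + 3)"
    proof -
      have "3 * s j + 3 = 2 * s j + (s j + 3)" by simp
      then have "2 ^ (2 * s j) * (1 / 2) ^ (3 * s j + 3) =
          (2 * (1 / 2) :: real) ^ (2 * s j) * (1 / 2) ^ (s j + 3)"
        by (simp only: power_add power_mult_distrib mult.assoc)
      then show ?thesis by simp
    qed
    \<comment> \<open>Strict monotonicity gives \<open>j \<le> s j\<close>, which yields a geometric
      series.\<close>
    also have "ennreal ((1 / 2) ^ (s j + 3)) \<le> ennreal ((1 / 2) ^ (j + 3))"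
      using strict_mono_imp_increasing[OF s(1), of j] by (intro ennreal_leI power_decreasing) auto
    finally show ?thesis .
  qed
  have "emeasure cantor_measure (\<Union>j. E j) \<le> (\<Sum>j. emeasure cantor_measure (E j))"
    using E_sets by (intro emeasure_subadditive_countably) auto
  also have "\<dots> \<le> (\<Sum>j. ennreal ((1 / 2) ^ (j + 3)))"
    by (intro suminf_le E_le) auto
  \<comment> \<open>The total is \<open>2 * (1 / 2) ^ 3\<close>, which is below 1, so some
    \<open>x\<close> avoids all \<open>E j\<close>.\<close>
  also have "\<dots> = ennreal (1 / 4)"
    using sums_mult2[OF geometric_sums[of "1 / 2 :: real"], of "(1 / 2) ^ 3"]
    by (intro suminf_ennreal_eq) (auto simp: power_add power3_eq_cube)
  also have "\<dots> < emeasure cantor_measure UNIV"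
    using emeasure_space_1 by (simp add: ennreal_less_one_iff)
  finally obtain x where x: "\<And>j. x \<notin> E j"
    by (metis UNIV_I UN_I UNIV_eq_I less_irrefl)
  \<comment> \<open>\<open>Z\<close> holds the coordinates that must vanish to put \<open>y\<close>
    into \<open>vanishing_seq m\<close> for all \<open>m\<close> outside \<open>a\<close>; elsewhere
    \<open>y\<close> copies \<open>x\<close>.\<close>
  define Z where "Z = (\<Union>m\<in>-a. {m..<2 * m})"
  define y where "y i = (x i \<and> i \<notin> Z)" for i
  have "n \<in> a" if "y \<notin> vanishing_seq n" for n
    using that by (auto simp: vanishing_seq_def y_def Z_def)
  then have "y \<in> N_star_set J vanishing_seq"
    unfolding N_star_set_iff by (intro omega_ideal_subset[OF J a]) auto
  moreover have "y \<notin> d n" if n: "n \<notin> b" for n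
  proof
    assume "y \<in> d n"
    obtain j where j: "\<beta> n = Suc j"
      using pos[OF n] gr0_implies_Suc by blast
    \<comment> \<open>Since \<open>n\<close> is in block \<open>j + 1\<close>, \<open>d n\<close>
      depends only on coordinates below \<open>s (j + 3)\<close>. An index \<open>m\<close> outside
      \<open>a\<close> forcing one of these lies in a block up to \<open>j + 2\<close>; the buffer
      pushes it to a block before \<open>j\<close>, so \<open>m < s j\<close>.\<close>
    have forced: "i < 2 * s j" if "i \<in> Z" "i < s (Suc (Suc (Suc j)))" for i
    proof -
      from that(1) obtain m where m: "m \<notin> a" "m \<le> i" "i < 2 * m"
        by (auto simp: Z_def)
      have "\<beta> m < Suc (Suc (Suc j))"
        using \<beta>(1)[of m] m(2) that(2) s(1) by (metis le_trans not_less strict_mono_less_eq)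
      then have "Suc (\<beta> m) \<le> j"
        using buf[OF n m(1)] j by auto
      then have "m < s j"
        using \<beta>(2)[of m] s_mono less_le_trans by blast
      then show ?thesis using m by simp
    qed
    \<comment> \<open>These are exactly the coordinates below \<open>s (j + 3)\<close> where
      \<open>x\<close> and \<open>y\<close> differ.\<close>
    define S where "S = {i. i < 2 * s j \<and> i \<in> Z \<and> x i}"
    have "n < s (Suc (Suc j))" using \<beta>(2)[of n] j by simp
    moreover have "y i = flip_on S x i" if "i < s (Suc (Suc (Suc j)))" for i
      using forced[OF _ that] by (auto simp: y_def flip_on_def S_def)
    ultimately have "flip_on S x \<in> d n"
      using supp \<open>y \<in> d n\<close> by blast
    then have "flip_on S x \<in> D j"
      using \<beta>[of n] j by (auto simp: D_def)
    then have "x \<in> E j" by (auto simp: E_def S_def)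
    with x show False by blast
  qed
  then have "{n. y \<in> d n} \<in> K"
    by (intro omega_ideal_subset[OF K b]) auto
  ultimately show ?thesis by (auto simp: N_set_iff)
qed

theorem theorem4p10:
  fixes J K :: "nat set set"
  assumes "omega_ideal J" and "omega_ideal K"
  shows "(nearly_coherent J K \<longleftrightarrow>
            (\<exists>K'. omega_ideal K' \<and> KB_bar_le J K' \<and> KB_bar_le K K')) \<and>
         (nearly_coherent J K \<longleftrightarrow>
            (\<exists>K'. omega_ideal K' \<and>
               N_star_ideal J \<union> N_star_ideal K \<subseteq> N_star_ideal K' \<and>
               N_star_ideal K' \<subseteq> N_ideal K' \<and>
               N_ideal K' \<subseteq> N_ideal J \<inter> N_ideal K)) \<and>
         (nearly_coherent J K \<longleftrightarrow> N_star_ideal J \<subseteq> N_ideal K)"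
  (is "(?i \<longleftrightarrow> ?ii) \<and> (?i \<longleftrightarrow> ?iii) \<and> (?i \<longleftrightarrow> ?iv)")
proof -
  have "?i \<Longrightarrow> ?ii"
    unfolding nearly_coherent_def KB_bar_le_def by blast
  moreover have "?ii \<Longrightarrow> ?iii"
    using KB_bar_le_N_star_ideal[OF assms(1)] KB_bar_le_N_star_ideal[OF assms(2)]
      KB_bar_le_N_ideal N_star_ideal_subset_N_ideal by (metis Int_greatest Un_least)
  moreover have "?iii \<Longrightarrow> ?iv" by blast
  moreover have "?iv \<Longrightarrow> ?i"
  proof (rule ccontr)
    assume iv: ?iv and "\<not> ?i"
    \<comment> \<open>The inclusion is tested on one set only, the one given by
      \<open>vanishing_seq\<close>.\<close>
    have "N_star_set J vanishing_seq \<in> N_star_ideal J"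
      using vanishing_seq_null by (auto simp: N_star_ideal_def)
    with iv obtain d where "d \<in> null_seqs" "N_star_set J vanishing_seq \<subseteq> N_set K d"
      by (auto simp: N_ideal_def)
    with not_nearly_coherent_avoid[OF assms \<open>\<not> ?i\<close>] show False by blast
  qed
  ultimately show ?thesis by blast
qed

end
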